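(* Let $x^*$ be the unique root of $p(x) = 8x^3 - 22x^2 + 10x - 1$ in $[0,1/6]$, and let $H$ be a 3-uniform hypergraph with $v(H) \geq 5$ and $\delta_2^{\mathrm{ess}}(H) \geq (1 - x^* )\, v(H)$. Then $w_{H,1}(O) \leq 1$ for every ordered triple $O=(x_1,x_2,x_3)$ of distinct vertices with $\{x_1,x_2,x_3\}\in E(H)$.
   Context: For a pair $p$ of vertices of a 3-uniform hypergraph $H$, $N(p)=\{v: p\cup\{v\}\in E(H)\}$, $\deg(p)=|N(p)|$, $\delta_2^{\mathrm{ess}}(H)=\min\{\deg(p):\deg(p)>0\}$. For a vertex set $S$, $\mathrm{CN}(S)=\bigcap_{p\subseteq S,|p|=2}N(p)$, written $\mathrm{CN}(x_1,\dots,x_k)$. For $r\in\{3,4,5\}$ an $r$-clique is an $r$-set of vertices all of whose 3-subsets are edges; $\mathcal{K}_r(H,S)$ is the set of $r$-cliques containing $S$. For $r\in\{2,3,4\}$, $W(v_1,\dots,v_r)=\prod_{i=2}^{r}1/|\mathcal{K}_{i+1}(H,\{v_1,\dots,v_i\})|$. For an ordered triple $O=(x_1,x_2,x_3)$ with $\{x_1,x_2,x_3\}\in E(H)$, $$w_{H,1}(O)=|\mathrm{CN}(x_1,x_2)|\sum_{y\in\mathrm{CN}(x_1,x_2,x_3)}\Big(W(x_1,y,x_2)-W(x_1,x_2,y)+\sum_{z\in\mathrm{CN}(x_1,x_2,x_3,y)}\big(W(x_1,y,x_2,z)-W(x_1,x_2,y,z)+W(x_1,y,z,x_2)-W(y,z,x_1,x_2)\big)\Big).$$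 *)

theory Defs
  imports Complex_Main
begin

record 'a hypergraph =
  verts :: "'a set"
  edges :: "'a set set"

definition three_uniform :: "'a hypergraph \<Rightarrow> bool" where
  "three_uniform H \<longleftrightarrow> finite (verts H) \<and> (\<forall>e\<in>edges H. e \<subseteq> verts H \<and> card e = 3)"

definition nbhd :: "'a hypergraph \<Rightarrow> 'a set \<Rightarrow> 'a set" where
  "nbhd H p = {v \<in> verts H. p \<union> {v} \<in> edges H}"

definition deg :: "'a hypergraph \<Rightarrow> 'a set \<Rightarrow> nat" where
  "deg H p = card (nbhd H p)"

text \<open>The minimum is unspecified for a hypergraph without edges.\<close>

definition delta2_ess :: "'a hypergraph \<Rightarrow> nat" where
  "delta2_ess H = Min {deg H p | p. p \<subseteq> verts H \<and> card p = 2 \<and> deg H p > 0}"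

definition CN :: "'a hypergraph \<Rightarrow> 'a set \<Rightarrow> 'a set" where
  "CN H S = verts H \<inter> (\<Inter>p\<in>{p. p \<subseteq> S \<and> card p = 2}. nbhd H p)"

definition is_clique :: "'a hypergraph \<Rightarrow> nat \<Rightarrow> 'a set \<Rightarrow> bool" where
  "is_clique H r K \<longleftrightarrow> K \<subseteq> verts H \<and> finite K \<and> card K = r \<and>
     (\<forall>e. e \<subseteq> K \<and> card e = 3 \<longrightarrow> e \<in> edges H)"

definition cliques :: "'a hypergraph \<Rightarrow> nat \<Rightarrow> 'a set \<Rightarrow> 'a set set" where
  "cliques H r S = {K. is_clique H r K \<and> S \<subseteq> K}"

text \<open>The vertex sequence \<open>v\<^sub>1, \<dots>, v\<^sub>r\<close> is a list, so \<open>set (take i vs)\<close> is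
  \<open>{v\<^sub>1, \<dots>, v\<^sub>i}\<close>.\<close>

definition W :: "'a hypergraph \<Rightarrow> 'a list \<Rightarrow> real" where
  "W H vs = (\<Prod>i = 2..length vs. 1 / real (card (cliques H (i + 1) (set (take i vs)))))"

fun w1 :: "'a hypergraph \<Rightarrow> 'a \<times> 'a \<times> 'a \<Rightarrow> real" where
  "w1 H (x1, x2, x3) =
     real (card (CN H {x1, x2})) *
     (\<Sum>y\<in>CN H {x1, x2, x3}.
        (W H [x1, y, x2] - W H [x1, x2, y] +
         (\<Sum>z\<in>CN H {x1, x2, x3, y}.
            (W H [x1, y, x2, z] - W H [x1, x2, y, z] +
             W H [x1, y, z, x2] - W H [y, z, x1, x2]))))"

definition p_star :: "real \<Rightarrow> real" where
  "p_star x = 8 * x ^ 3 - 22 * x ^ 2 + 10 * x - 1"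

definition x_star :: real where
  "x_star = (THE x. x \<in> {0..1/6} \<and> p_star x = 0)"

lemma p_star_unique_root: "\<exists>!x. x \<in> {0..1/6} \<and> p_star x = 0"
proof (rule ex_ex1I)
  have "continuous_on {0..1/6} p_star"
    unfolding p_star_def by (intro continuous_intros)
  moreover have "p_star 0 \<le> 0" "0 \<le> p_star (1/6)"
    by (simp_all add: p_star_def power_divide)
  ultimately show "\<exists>x. x \<in> {0..1/6} \<and> p_star x = 0"
    using IVT'[of p_star 0 0 "1/6"] by auto
next
  have less: "p_star a < p_star b" if "0 \<le> a" "a < b" "b \<le> 1/6" for a b
  proof -
    have "p_star b - p_star a = (b - a) * (8 * (a^2 + a * b + b^2) + (10 - 22 * (a + b)))"
      by (simp add: p_star_def algebra_simps power2_eq_square power3_eq_cube)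
    moreover have "8 * (a^2 + a * b + b^2) \<ge> 0"
      using that by simp
    moreover have "10 - 22 * (a + b) > 0"
      using that by simp
    ultimately have "p_star b - p_star a > 0"
      using that by (metis add_nonneg_pos diff_gt_0_iff_gt mult_pos_pos)
    thus ?thesis
      by simp
  qed
  show "x = y" if "x \<in> {0..1/6} \<and> p_star x = 0" "y \<in> {0..1/6} \<and> p_star y = 0" for x y
    using that less[of x y] less[of y x] by (cases x y rule: linorder_cases) auto
qed

end

theory Submission imports Defs begin

text \<open>
  Put \<open>n = v(H)\<close> and \<open>X = x\<^sup>* n\<close>. Every pair inside a clique of size at least 3 has degree
  in \<open>[n - X, n]\<close>, and the number of cliques of size \<open>r + 1\<close> containing an \<open>r\<close>-clique \<open>S\<close> is
  \<open>|CN(S)|\<close>, which inclusion-exclusion bounds below by pair degrees. It suffices that each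
  summand indexed by \<open>y\<close>, multiplied by \<open>D = deg(x\<^sub>1, x\<^sub>2)\<close>, is at most \<open>1/n\<close>. Its part without \<open>z\<close>
  is at most \<open>X / ((n - X)(n - 2X))\<close>. Since there are at most \<open>c = |CN(x\<^sub>1, x\<^sub>2, y)|\<close> choices of \<open>z\<close>,
  bounding each summand indexed by \<open>z\<close> by \<open>2X / ((n - X)(n - 4X)) / c\<close> is enough: the extremal case
  is \<open>D = deg(y, z) = n\<close> with all other degrees equal to \<open>n - X\<close>. The two bounds add up to \<open>1/n\<close>
  exactly when \<open>p(x\<^sup>*) = 0\<close>.
\<close>

section \<open>Cliques and common neighbourhoods\<close>

lemma nbhd_subset_verts: "nbhd H p \<subseteq> verts H"
  by (auto simp: nbhd_def)

lemma CN_subset_verts: "CN H S \<subseteq> verts H"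
  by (auto simp: CN_def)

lemma CN_antimono: "S \<subseteq> T \<Longrightarrow> CN H T \<subseteq> CN H S"
  by (auto simp: CN_def)

text \<open>If \<open>v\<close> lay in \<open>S\<close>, some other \<open>w\<close> in
  \<open>S\<close> would give \<open>v\<close> in \<open>nbhd H {v, w}\<close>, making the 2-set
  \<open>{v, w}\<close> an edge. For \<open>card S < 2\<close> the intersection in \<open>CN\<close>
  is over no pairs, and \<open>CN H S\<close> is all of \<open>verts H\<close>.\<close>

lemma mem_CN_not_mem:
  assumes "three_uniform H" "finite S" "card S \<ge> 2" "v \<in> CN H S"
  shows "v \<notin> S"
proof
  assume "v \<in> S"
  have "card (S - {v}) \<ge> 1"
    using assms \<open>v \<in> S\<close> by (simp add: card_Diff_singleton)
  then obtain w where w: "w \<in> S" "w \<noteq> v"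
    by (metis card.empty Diff_iff all_not_in_conv insertI1 not_one_le_zero)
  with \<open>v \<in> S\<close> have "{v, w} \<subseteq> S" "card {v, w} = 2"
    by auto
  with assms(4) have "v \<in> nbhd H {v, w}"
    unfolding CN_def by blast
  then have "{v, w} \<in> edges H"
    by (simp add: nbhd_def insert_absorb)
  with assms(1) \<open>card {v, w} = 2\<close> show False
    unfolding three_uniform_def by fastforce
qed

lemma is_clique_insert:
  assumes H: "three_uniform H" and S: "is_clique H r S" and r: "r \<ge> 2" and v: "v \<in> CN H S"
  shows "is_clique H (Suc r) (insert v S)"
proof -
  have fin: "finite S" and card: "card S = r" and sub: "S \<subseteq> verts H"
    using S by (auto simp: is_clique_def)
  have notin: "v \<notin> S"
    using mem_CN_not_mem[OF H fin _ v] card r by simp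
  have "e \<in> edges H" if e: "e \<subseteq> insert v S" "card e = 3" for e
  proof (cases "v \<in> e")
    case True
    have "finite e"
      using e fin finite_subset by blast
    with True e have "e - {v} \<subseteq> S" "card (e - {v}) = 2"
      by (auto simp: card_Diff_singleton)
    with v have "v \<in> nbhd H (e - {v})"
      unfolding CN_def by blast
    with True show ?thesis
      by (simp add: nbhd_def insert_absorb)
  next
    case False
    with e S show ?thesis
      by (auto simp: is_clique_def)
  qed
  moreover have "v \<in> verts H"
    using subsetD[OF CN_subset_verts v] .
  ultimately show ?thesis
    using fin card sub notin by (auto simp: is_clique_def)
qed

lemma is_clique_mono:
  "is_clique H r K \<Longrightarrow> S \<subseteq> K \<Longrightarrow> card S = m \<Longrightarrow> is_clique H m S"
  unfolding is_clique_def by (meson finite_subset subset_trans)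

text \<open>Adjoining a vertex is a bijection from \<open>CN H S\<close> onto the cliques one larger
  that contain \<open>S\<close>. Since \<open>is_clique H 2\<close> holds of every pair of vertices,
  the case \<open>r = 2\<close> covers the first factor of \<open>W\<close>.\<close>

lemma card_cliques_eq_card_CN:
  assumes H: "three_uniform H" and S: "is_clique H r S" and r: "r \<ge> 2"
  shows "card (cliques H (Suc r) S) = card (CN H S)"
proof -
  have fin: "finite S" and card: "card S = r"
    using S by (auto simp: is_clique_def)
  have notin: "v \<notin> S" if "v \<in> CN H S" for v
    using mem_CN_not_mem[OF H fin _ that] card r by simp
  have "cliques H (Suc r) S = (\<lambda>v. insert v S) ` CN H S"
  proof (intro equalityI subsetI)
    fix K assume "K \<in> cliques H (Suc r) S"
    then have K: "is_clique H (Suc r) K" "S \<subseteq> K"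
      by (auto simp: cliques_def)
    then have finK: "finite K" and cardK: "card K = Suc r" and subK: "K \<subseteq> verts H"
      by (auto simp: is_clique_def)
    have "card (K - S) = 1"
      using K fin card cardK by (simp add: card_Diff_subset)
    then obtain v where v: "K - S = {v}"
      using card_1_singletonE by blast
    have "v \<in> nbhd H p" if p: "p \<subseteq> S" "card p = 2" for p
    proof -
      have "finite p" "v \<notin> p"
        using p v fin finite_subset by blast+
      with p have "card (p \<union> {v}) = 3"
        by simp
      moreover have "p \<union> {v} \<subseteq> K"
        using p v K by blast
      ultimately have "p \<union> {v} \<in> edges H"
        using K(1) by (simp add: is_clique_def)
      then show ?thesis
        using v subK by (auto simp: nbhd_def)
    qed
    then have "v \<in> CN H S"
      using v subK by (auto simp: CN_def)
    moreover have "K = insert v S"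
      using v K by blast
    ultimately show "K \<in> (\<lambda>v. insert v S) ` CN H S"
      by blast
  next
    fix K assume "K \<in> (\<lambda>v. insert v S) ` CN H S"
    then show "K \<in> cliques H (Suc r) S"
      using is_clique_insert[OF H S r] by (auto simp: cliques_def)
  qed
  moreover have "inj_on (\<lambda>v. insert v S) (CN H S)"
    using notin by (auto simp: inj_on_def)
  ultimately show ?thesis
    by (simp add: card_image)
qed

text \<open>A vertex of \<open>K\<close> outside \<open>p\<close> completes \<open>p\<close> to an
  edge, so \<open>p\<close> has positive degree and takes part in the minimum.\<close>

lemma delta2_ess_le_deg:
  assumes H: "three_uniform H" and K: "is_clique H r K" and r: "r \<ge> 3"
    and p: "p \<subseteq> K" "card p = 2"
  shows "delta2_ess H \<le> deg H p"
proof -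
  let ?A = "{deg H p | p. p \<subseteq> verts H \<and> card p = 2 \<and> deg H p > 0}"
  have fin: "finite (verts H)"
    using H by (simp add: three_uniform_def)
  have finK: "finite K" and cardK: "card K = r" and subK: "K \<subseteq> verts H"
    using K by (auto simp: is_clique_def)
  have finp: "finite p"
    using p finK finite_subset by blast
  have "card (K - p) \<noteq> 0"
    using p finp cardK r by (simp add: card_Diff_subset)
  then obtain v where v: "v \<in> K" "v \<notin> p"
    by (metis DiffE card.empty equals0I)
  then have "card (p \<union> {v}) = 3" "p \<union> {v} \<subseteq> K"
    using p finp by auto
  then have "v \<in> nbhd H p"
    using K v subK by (auto simp: nbhd_def is_clique_def)
  moreover have "finite (nbhd H p)"
    using finite_subset[OF nbhd_subset_verts fin] .
  ultimately have "deg H p > 0"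
    unfolding deg_def using card_gt_0_iff by blast
  then have "deg H p \<in> ?A"
    using p subK by blast
  moreover have "finite ?A"
    by (rule finite_subset[of _ "deg H ` Pow (verts H)"]) (use fin in auto)
  ultimately show ?thesis
    unfolding delta2_ess_def by (rule Min_le[rotated])
qed

section \<open>Inclusion-exclusion bounds for common neighbourhoods\<close>

lemma card_Int_ge:
  assumes "finite V" "A \<subseteq> V" "B \<subseteq> V"
  shows "real (card (A \<inter> B)) \<ge> real (card A) + real (card B) - real (card V)"
proof -
  have "card A + card B = card (A \<union> B) + card (A \<inter> B)"
    using assms finite_subset by (intro card_Un_Int) auto
  moreover have "card (A \<union> B) \<le> card V"
    using assms by (intro card_mono) auto
  ultimately show ?thesis
    by linarith
qed

lemma subset_insert_card_2:
  assumes "p \<subseteq> insert v S" "card p = 2" "v \<in> p" "v \<notin> S"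
  obtains w where "w \<in> S" "p = {w, v}"
proof -
  obtain a b where "p = {a, b}" "a \<noteq> b"
    using assms(2) by (auto simp: card_2_iff)
  with assms that show ?thesis
    by (metis insert_commute insert_iff singleton_iff subset_iff)
qed

text \<open>The pairs in \<open>insert v S\<close> are the pairs in \<open>S\<close> and the pairs
  \<open>{w, v}\<close>, so a new vertex adds one neighbourhood to the intersection for each old
  vertex.\<close>

lemma CN_insert:
  assumes "v \<notin> S"
  shows "CN H (insert v S) = CN H S \<inter> (\<Inter>w\<in>S. nbhd H {w, v})"
proof (intro equalityI subsetI)
  fix t assume t: "t \<in> CN H (insert v S)"
  have "t \<in> nbhd H {w, v}" if "w \<in> S" for w
  proof -
    have "w \<noteq> v"
      using that assms by blast
    with that have "{w, v} \<subseteq> insert v S" "card {w, v} = 2"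
      by auto
    with t show ?thesis
      unfolding CN_def by blast
  qed
  moreover have "t \<in> CN H S"
    using t CN_antimono[of S "insert v S"] by blast
  ultimately show "t \<in> CN H S \<inter> (\<Inter>w\<in>S. nbhd H {w, v})"
    by blast
next
  fix t assume t: "t \<in> CN H S \<inter> (\<Inter>w\<in>S. nbhd H {w, v})"
  have "t \<in> nbhd H p" if p: "p \<subseteq> insert v S" "card p = 2" for p
  proof (cases "v \<in> p")
    case True
    then obtain w where "w \<in> S" "p = {w, v}"
      using subset_insert_card_2 p assms by metis
    with t show ?thesis by blast
  next
    case False
    with p have "p \<subseteq> S" by blast
    with t p show ?thesis by (auto simp: CN_def)
  qed
  with t show "t \<in> CN H (insert v S)"
    by (auto simp: CN_def)
qed

lemma CN_pair:
  assumes "a \<noteq> b"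
  shows "CN H {a, b} = nbhd H {a, b}"
proof -
  have "{p. p \<subseteq> {a, b} \<and> card p = 2} = {{a, b}}"
    using assms by (auto simp: card_2_iff)
  then show ?thesis
    using nbhd_subset_verts[of H "{a, b}"] by (auto simp: CN_def)
qed

lemma card_CN_3_ge:
  assumes fin: "finite (verts H)" and "distinct [a, b, c]"
  shows "real (card (CN H {a, b, c})) \<ge>
    real (deg H {a, b}) + real (deg H {a, c}) + real (deg H {b, c}) - 2 * real (card (verts H))"
proof -
  have eq: "CN H {a, b, c} = nbhd H {a, b} \<inter> nbhd H {a, c} \<inter> nbhd H {b, c}"
    using assms(2) CN_insert[of c "{a, b}" H] by (auto simp: CN_pair insert_commute)
  show ?thesis
    using card_Int_ge[OF fin, of "nbhd H {a, b} \<inter> nbhd H {a, c}" "nbhd H {b, c}"]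
      card_Int_ge[OF fin, of "nbhd H {a, b}" "nbhd H {a, c}"]
      nbhd_subset_verts[of H]
    unfolding eq deg_def by (auto simp: le_infI1)
qed

text \<open>\<open>CN H {a, b, c}\<close> is kept whole instead of being expanded into degrees: the
  extremal argument compares the two cardinalities through their ratio.\<close>

lemma card_CN_4_ge:
  assumes fin: "finite (verts H)" and "distinct [a, b, c, d]"
  shows "real (card (CN H {a, b, c, d})) \<ge>
    real (card (CN H {a, b, c})) + real (deg H {a, d}) + real (deg H {b, d}) + real (deg H {c, d})
      - 3 * real (card (verts H))"
proof -
  have "{a, b, c, d} = insert d {a, b, c}"
    by auto
  then have eq: "CN H {a, b, c, d} = CN H {a, b, c} \<inter> nbhd H {a, d} \<inter> nbhd H {b, d} \<inter> nbhd H {c, d}"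
    using assms(2) CN_insert[of d "{a, b, c}" H] by auto
  show ?thesis
    using card_Int_ge[OF fin, of "CN H {a, b, c} \<inter> nbhd H {a, d} \<inter> nbhd H {b, d}" "nbhd H {c, d}"]
      card_Int_ge[OF fin, of "CN H {a, b, c} \<inter> nbhd H {a, d}" "nbhd H {b, d}"]
      card_Int_ge[OF fin, of "CN H {a, b, c}" "nbhd H {a, d}"]
      nbhd_subset_verts[of H] CN_subset_verts[of H "{a, b, c}"]
    unfolding eq deg_def by (auto simp: le_infI1)
qed

section \<open>Weights in terms of degrees and common neighbourhoods\<close>

lemma W_3:
  assumes H: "three_uniform H" and K: "is_clique H 3 {a, b, c}" and d: "distinct [a, b, c]"
  shows "W H [a, b, c] = 1 / (real (deg H {a, b}) * real (card (CN H {a, b, c})))"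
proof -
  have "is_clique H 2 {a, b}"
    using is_clique_mono[OF K, of "{a, b}" 2] d by simp
  from card_cliques_eq_card_CN[OF H this] card_cliques_eq_card_CN[OF H K] d
  show ?thesis
    by (simp add: W_def CN_pair deg_def numeral_3_eq_3 numeral_2_eq_2 atLeastAtMostSuc_conv insert_commute)
qed

lemma W_4:
  assumes H: "three_uniform H" and K: "is_clique H 4 {a, b, c, d}" and d: "distinct [a, b, c, d]"
  shows "W H [a, b, c, d] = 1 / (real (deg H {a, b}) * real (card (CN H {a, b, c}))
    * real (card (CN H {a, b, c, d})))"
proof -
  have "is_clique H 3 {a, b, c}" "is_clique H 2 {a, b}"
    using is_clique_mono[OF K, of "{a, b, c}" 3] is_clique_mono[OF K, of "{a, b}" 2] d by simp_all
  from card_cliques_eq_card_CN[OF H this(1)] card_cliques_eq_card_CN[OF H this(2)]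
    card_cliques_eq_card_CN[OF H K] d
  show ?thesis
    by (simp add: W_def CN_pair deg_def eval_nat_numeral atLeastAtMostSuc_conv insert_commute)
qed

section \<open>The extremal inequalities\<close>

text \<open>The end points are excluded because p takes the values -1 and 5/54 there. The strict
  bounds keep the later denominators positive.\<close>

lemma x_star_props: "0 < x_star" "x_star < 1/6" "p_star x_star = 0"
proof -
  have *: "x_star \<in> {0..1/6} \<and> p_star x_star = 0"
    unfolding x_star_def by (rule theI'[OF p_star_unique_root])
  then show "p_star x_star = 0" by simp
  have "p_star 0 \<noteq> 0" "p_star (1/6) \<noteq> 0"
    by (simp_all add: p_star_def power_divide)
  with * have "x_star \<noteq> 0" "x_star \<noteq> 1/6"
    by metis+
  with * show "0 < x_star" "x_star < 1/6"
    by auto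
qed

text \<open>\<open>N\<close> is the number of vertices and \<open>X\<close> is
  \<open>x_star * N\<close>; \<open>root\<close> is the equation of \<open>x_star\<close> made
  homogeneous by the factor \<open>N^3\<close>.\<close>

locale extremal =
  fixes N X :: real
  assumes X_pos: "0 < X" and X_less: "6 * X < N"
    and root: "8 * X^3 - 22 * X^2 * N + 10 * X * N^2 - N^3 = 0"
begin

text \<open>This is what remains of the bound per \<open>z\<close> once all other quantities are
  extremal; \<open>u\<close> and \<open>v\<close> are the excesses of \<open>D\<close> and
  \<open>g\<close> over \<open>N - X\<close>. Equality holds at \<open>u = v = X\<close>.\<close>

lemma ratio_bound:
  assumes v: "0 \<le> v" "v \<le> X" and u: "0 \<le> u" "u \<le> X"
    and D: "D = N - X + u" and g: "g = N - X + v"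
  shows "(u + v * (D * (D - 2*X)) / (g * (g - 2*X))) * (N - 4*X) \<le> 2*X * (N - 6*X + u + v)"
proof -
  have gpos: "g > 0" "g - 2*X > 0"
    using v g X_less X_pos by linarith+
  have Dpos: "D > 0" "D - 2*X > 0"
    using u D X_less X_pos by linarith+
  have hpos: "g * (g - 2*X) > 0"
    using gpos by simp
  show ?thesis
  proof (cases "u \<le> v")
    case True
    \<comment> \<open>Here the quotient multiplying \<open>v\<close> is at most 1, and
      \<open>u + v \<le> 2*X\<close> finishes.\<close>
    have "D * (D - 2*X) \<le> g * (g - 2*X)"
      using True D g Dpos gpos by (intro mult_mono) auto
    then have "v * (D * (D - 2*X)) / (g * (g - 2*X)) \<le> v"
      using hpos v by (simp add: divide_le_eq mult_left_mono)
    then have "(u + v * (D * (D - 2*X)) / (g * (g - 2*X))) * (N - 4*X) \<le> (u + v) * (N - 4*X)"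
      using X_less X_pos by (intro mult_right_mono) auto
    also have "\<dots> = (u + v) * (N - 6*X) + 2*X*(u+v)"
      by (simp add: algebra_simps)
    also have "\<dots> \<le> 2*X * (N - 6*X) + 2*X*(u+v)"
      using u v X_less by (intro add_right_mono mult_right_mono) auto
    finally show ?thesis
      by (simp add: algebra_simps)
  next
    case False
    \<comment> \<open>In cleared form: \<open>v / (g * (g - 2*X))\<close> is largest at
      \<open>v = X\<close>, where \<open>g = N\<close>.\<close>
    have "v * ((N - X + X) * (N - 3*X + X)) \<le> X * (g * (g - 2*X))"
    proof -
      have "X * (g * (g - 2*X)) - v * ((N - X + X) * (N - 3*X + X))
        = (X - v) * ((N - X) * (N - 3*X) - X * v)"
        unfolding g by (simp add: algebra_simps)
      moreover have "X * v \<le> (N - X) * (N - 3*X)"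
        using v X_less X_pos by (intro mult_mono) auto
      ultimately show ?thesis
        using v by (smt (verit) mult_nonneg_nonneg)
    qed
    then have v_le: "v / (g * (g - 2*X)) \<le> X / (N * (N - 2*X))"
      using hpos X_less X_pos by (simp add: field_simps)
    have "v * (D + g - 2*X) / (g * (g - 2*X)) * (N - 4*X)
        = v / (g * (g - 2*X)) * ((D + g - 2*X) * (N - 4*X))"
      by simp
    also have "\<dots> \<le> X / (N * (N - 2*X)) * ((2*N - 2*X) * (N - 4*X))"
      using v_le u v D g X_less X_pos
      by (intro mult_mono mult_right_mono) auto
    also have "\<dots> = N - 6*X"
    proof -
      \<comment> \<open>Expanded, this is exactly the equation \<open>root\<close>.\<close>
      have "X * ((2*N - 2*X) * (N - 4*X)) = (N - 6*X) * (N * (N - 2*X))"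
        using root by (simp add: algebra_simps power2_eq_square power3_eq_cube)
      then show ?thesis
        using X_less X_pos by (simp add: field_simps)
    qed
    finally have key: "v * (D + g - 2*X) / (g * (g - 2*X)) * (N - 4*X) \<le> N - 6*X" .
    \<comment> \<open>The excess of the quotient over 1 has the factor \<open>D - g = u - v\<close>;
      its cofactor is what \<open>key\<close> controls.\<close>
    have "v * (D * (D - 2*X)) / (g * (g - 2*X))
        = v + (u - v) * (v * (D + g - 2*X) / (g * (g - 2*X)))"
    proof -
      have "D * (D - 2*X) = g * (g - 2*X) + (u - v) * (D + g - 2*X)"
        unfolding D g by (simp add: algebra_simps)
      then show ?thesis
        using gpos by (simp add: add_divide_distrib distrib_left mult.left_commute)
    qed
    then have "(u + v * (D * (D - 2*X)) / (g * (g - 2*X))) * (N - 4*X)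
      = (u + v) * (N - 4*X) + (u - v) * (v * (D + g - 2*X) / (g * (g - 2*X)) * (N - 4*X))"
      by (simp add: algebra_simps)
    also have "\<dots> \<le> (u + v) * (N - 4*X) + (u - v) * (N - 6*X)"
      using key False by (intro add_left_mono mult_left_mono) auto
    also have "\<dots> = 2*X*(u+v) + 2*u*(N - 6*X)"
      by (simp add: algebra_simps)
    also have "\<dots> \<le> 2*X*(u+v) + 2*X*(N - 6*X)"
      using u X_less by (intro add_left_mono mult_right_mono) auto
    finally show ?thesis
      by (simp add: algebra_simps)
  qed
qed

text \<open>In the application \<open>D\<close>, \<open>a\<close>, \<open>g\<close> are the degrees
  of \<open>{x1, x2}\<close>, \<open>{x1, y}\<close>, \<open>{y, z}\<close>, and \<open>c\<close>,
  \<open>c'\<close>, \<open>k\<close> count the common neighbours of \<open>{x1, x2, y}\<close>,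
  \<open>{x1, y, z}\<close>, \<open>{x1, x2, y, z}\<close>. After multiplication by
  \<open>c\<close>, lowering \<open>a\<close>, \<open>c\<close>, \<open>k\<close>, \<open>c'\<close>
  to their least values leads to \<open>ratio_bound\<close>.\<close>

lemma inner_bound:
  assumes D: "N - X \<le> D" "D \<le> N" and a: "N - X \<le> a" and g: "N - X \<le> g" "g \<le> N"
    and c: "D - 2*X \<le> c" and k: "c - 2*X - (N - g) \<le> k" and c': "g - 2*X \<le> c'"
  shows "D * (1/(a*c*k) - 1/(D*c*k) + 1/(a*c'*k) - 1/(g*c'*k))
    \<le> 2*X / ((N - X) * (N - 4*X)) / c"
proof -
  define P u v where "P = N - X" and "u = D - (N - X)" and "v = g - (N - X)"
  \<comment> \<open>The lower bound for \<open>k\<close> at the least possible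
    \<open>c = D - 2*X\<close>.\<close>
  define q where "q = N - 6*X + u + v"
  have pos: "P > 0" "D > 0" "a > 0" "g > 0" "c > 0" "c' > 0" "D - 2*X > 0" "g - 2*X > 0" "q > 0"
    and uv: "0 \<le> u" "u \<le> X" "0 \<le> v" "v \<le> X" and qk: "q \<le> k"
    and "k > 0" and "a \<ge> P"
    using assms X_pos X_less by (auto simp: u_def v_def q_def P_def)
  have "D/a - 1 \<le> u/P"
  proof -
    have "D/a \<le> D/P"
      using pos \<open>a \<ge> P\<close> by (simp add: frac_le)
    also have "D/P = u/P + 1"
      using pos by (simp add: u_def P_def field_simps)
    finally show ?thesis by simp
  qed
  \<comment> \<open>\<open>D/a - 1\<close> may be negative, so it is replaced by the nonnegative
    \<open>u/P\<close> before \<open>k\<close> is lowered to \<open>q\<close>. The same order is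
    followed for \<open>1/a - 1/g\<close> below.\<close>
  then have "(D/a - 1) / k \<le> u/P/k"
    using \<open>k > 0\<close> by (intro divide_right_mono) auto
  also have "\<dots> \<le> u/P/q"
    using qk pos uv by (intro divide_left_mono) auto
  finally have first: "(D/a - 1) / k \<le> u/P/q" .
  \<comment> \<open>With \<open>t = 3*X - v\<close> the bound on \<open>k\<close> is
    \<open>c - t\<close>, and \<open>c / (c - t)\<close> decreases in \<open>c\<close>; at
    \<open>c = D - 2*X\<close> its denominator is \<open>q\<close>.\<close>
  have "c * q \<le> (D - 2*X) * k"
  proof -
    have "(c - (D - 2*X)) * (3*X - v) \<ge> 0"
      using c uv X_pos by simp
    then have "c * q \<le> (D - 2*X) * (c - 2*X - (N - g))"
      by (simp add: q_def u_def v_def algebra_simps)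
    also have "\<dots> \<le> (D - 2*X) * k"
      using k pos by (intro mult_left_mono) auto
    finally show ?thesis .
  qed
  then have ck: "c / k \<le> (D - 2*X) / q"
    using pos \<open>k > 0\<close> by (simp add: field_simps)
  have "1/a - 1/g \<le> 1/P - 1/g"
    using pos \<open>a \<ge> P\<close> by (simp add: frac_le)
  also have "\<dots> = v / (P*g)"
    using pos by (simp add: v_def P_def field_simps)
  finally have "D * (1/a - 1/g) * (c/k) / c' \<le> D * (v / (P*g)) * (c/k) / c'"
    using pos \<open>k > 0\<close> by (intro divide_right_mono mult_right_mono mult_left_mono) auto
  also have "\<dots> \<le> D * (v / (P*g)) * ((D - 2*X) / q) / (g - 2*X)"
  proof (rule frac_le)
    show "D * (v / (P*g)) * (c/k) \<le> D * (v / (P*g)) * ((D - 2*X) / q)"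
      using ck pos uv by (intro mult_left_mono) auto
  qed (use pos uv c' in auto)
  finally have second: "D * (1/a - 1/g) * (c/k) / c' \<le> D * (v / (P*g)) * ((D - 2*X) / q) / (g - 2*X)" .
  have "c * (D * (1/(a*c*k) - 1/(D*c*k) + 1/(a*c'*k) - 1/(g*c'*k)))
    = (D/a - 1) / k + D * (1/a - 1/g) * (c/k) / c'"
    using pos \<open>k > 0\<close> by (simp add: field_simps)
  also have "\<dots> \<le> u/P/q + D * (v / (P*g)) * ((D - 2*X) / q) / (g - 2*X)"
    using first second by (rule add_mono)
  also have "\<dots> = (u + v * (D * (D - 2*X)) / (g * (g - 2*X))) / (P * q)"
    using pos by (simp add: add_divide_distrib mult_ac)
  also have "\<dots> \<le> 2*X / (P * (N - 4*X))"
  proof -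
    have "(u + v * (D * (D - 2*X)) / (g * (g - 2*X))) * (N - 4*X) \<le> 2*X * q"
      unfolding q_def using ratio_bound[OF uv(3,4,1,2), of D g] by (simp add: u_def v_def add.assoc)
    then have "(u + v * (D * (D - 2*X)) / (g * (g - 2*X))) / q \<le> 2*X / (N - 4*X)"
      using pos X_less X_pos by (simp add: divide_le_eq le_divide_eq mult.commute)
    then have "(u + v * (D * (D - 2*X)) / (g * (g - 2*X))) / q / P \<le> 2*X / (N - 4*X) / P"
      using pos by (intro divide_right_mono) auto
    then show ?thesis
      by (simp add: mult.commute)
  qed
  finally show ?thesis
    unfolding P_def pos_le_divide_eq[OF \<open>c > 0\<close>] by (subst mult.commute)
qed

text \<open>The left side is \<open>(D/a - 1) / c\<close>, at most
  \<open>u / (N - X) / (D - 2*X)\<close> with \<open>D = N - X + u\<close>. This increases in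
  \<open>u\<close> since \<open>N - 3*X > 0\<close>, so \<open>u = X\<close> is the worst
  case.\<close>

lemma outer_bound:
  assumes D: "N - X \<le> D" "D \<le> N" and a: "N - X \<le> a" and c: "D - 2*X \<le> c"
  shows "D * (1/(a*c) - 1/(D*c)) \<le> X / ((N - X) * (N - 2*X))"
proof -
  define u where "u = D - (N - X)"
  have pos: "N - X > 0" "D > 0" "a > 0" "c > 0" "D - 2*X > 0" and u: "0 \<le> u" "u \<le> X"
    using assms X_pos X_less by (auto simp: u_def)
  have "D/a \<le> D/(N - X)"
    using pos a by (simp add: frac_le)
  also have "\<dots> = u/(N - X) + 1"
    using pos by (simp add: u_def field_simps)
  finally have *: "D/a - 1 \<le> u/(N - X)" by simp
  have "D * (1/(a*c) - 1/(D*c)) = (D/a - 1) / c"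
    using pos by (simp add: field_simps)
  also have "\<dots> \<le> u/(N - X)/(D - 2*X)"
    using * pos c u by (smt (verit) divide_left_mono divide_right_mono divide_nonneg_pos mult_pos_pos)
  also have "\<dots> = u/(D - 2*X)/(N - X)"
    by simp
  also have "\<dots> \<le> X/(N - 2*X)/(N - X)"
  proof (intro divide_right_mono)
    have "(X - u) * (N - 3*X) \<ge> 0"
      using u X_less X_pos by simp
    then show "u/(D - 2*X) \<le> X/(N - 2*X)"
      using pos X_less X_pos by (simp add: u_def divide_le_eq le_divide_eq algebra_simps)
  qed (use pos in auto)
  finally show ?thesis
    by (simp add: mult.commute)
qed

text \<open>Clearing denominators gives
  \<open>N * X * (3*N - 8*X) = (N - X) * (N - 2*X) * (N - 4*X)\<close>, which is \<open>root\<close>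
  rearranged.\<close>

lemma bounds_sum: "X / ((N - X) * (N - 2*X)) + 2*X / ((N - X) * (N - 4*X)) = 1 / N"
proof -
  have "N - X \<noteq> 0" "N - 2*X \<noteq> 0" "N - 4*X \<noteq> 0" "N \<noteq> 0"
    using X_less X_pos by auto
  then show ?thesis
    using root by (simp add: divide_simps) (simp add: algebra_simps power2_eq_square power3_eq_cube)
qed

end

section \<open>Summation of the bounds over \<open>y\<close> and \<open>z\<close>\<close>

theorem theorem3p5:
  fixes H :: "'a hypergraph" and x1 x2 x3 :: 'a
  assumes "three_uniform H"
    and "card (verts H) \<ge> 5"
    and "real (delta2_ess H) \<ge> (1 - x_star) * real (card (verts H))"
    and "distinct [x1, x2, x3]"
    and "{x1, x2, x3} \<in> edges H"
  shows "w1 H (x1, x2, x3) \<le> 1"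
proof -
  note H = assms(1)
  define N where "N = real (card (verts H))"
  define X where "X = x_star * N"
  have N: "N > 0"
    using assms(2) by (simp add: N_def)
  have fin: "finite (verts H)"
    using H by (simp add: three_uniform_def)
  interpret extremal N X
  proof
    show "0 < X" "6 * X < N"
      using N x_star_props(1,2) by (auto simp: X_def)
    have "8 * X^3 - 22 * X^2 * N + 10 * X * N^2 - N^3 = N^3 * p_star x_star"
      by (simp add: X_def p_star_def algebra_simps power2_eq_square power3_eq_cube)
    then show "8 * X^3 - 22 * X^2 * N + 10 * X * N^2 - N^3 = 0"
      by (simp add: x_star_props(3))
  qed
  have deg_le: "real (deg H p) \<le> N" for p
    unfolding deg_def N_def using card_mono[OF fin nbhd_subset_verts] by simp
  have deg_ge: "N - X \<le> real (deg H {a, b})"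
    if "is_clique H r K" "r \<ge> 3" "a \<in> K" "b \<in> K" "a \<noteq> b" for r K a b
    using delta2_ess_le_deg[OF H that(1,2), of "{a, b}"] that assms(3)
    by (simp add: X_def N_def algebra_simps)
  have clique3: "is_clique H 3 {x1, x2, x3}"
  proof -
    have "e = {x1, x2, x3}" if "e \<subseteq> {x1, x2, x3}" "card e = 3" for e
      using that assms(4) by (intro card_subset_eq) auto
    then show ?thesis
      using H assms(4,5) by (auto simp: is_clique_def three_uniform_def)
  qed
  define D where "D = real (deg H {x1, x2})"
  have D: "N - X \<le> D" "D \<le> N"
    using deg_ge[OF clique3, of x1 x2] deg_le assms(4) by (auto simp: D_def)
  define inner where "inner y z = W H [x1, y, x2, z] - W H [x1, x2, y, z] +
             W H [x1, y, z, x2] - W H [y, z, x1, x2]" for y z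
  define outer where "outer y = W H [x1, y, x2] - W H [x1, x2, y]" for y
  have y_bound: "D * (outer y + (\<Sum>z\<in>CN H {x1, x2, x3, y}. inner y z)) \<le> 1 / N"
    if y: "y \<in> CN H {x1, x2, x3}" for y
  proof -
    have dy: "distinct [x1, x2, x3, y]"
      using mem_CN_not_mem[OF H _ _ y] assms(4) by auto
    have clique4: "is_clique H 4 {x1, x2, x3, y}"
      using is_clique_insert[OF H clique3 _ y] by (simp add: insert_commute)
    have clique12y: "is_clique H 3 {x1, x2, y}"
      using is_clique_mono[OF clique4, of "{x1, x2, y}" 3] dy by simp
    define a where "a = real (deg H {x1, y})"
    define c where "c = real (card (CN H {x1, x2, y}))"
    have a: "N - X \<le> a"
      using deg_ge[OF clique4, of x1 y] dy by (simp add: a_def)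
    have c: "D - 2*X \<le> c"
      using card_CN_3_ge[OF fin, of x1 x2 y] dy a deg_ge[OF clique4, of x2 y]
      by (simp add: a_def c_def D_def N_def)
    have c_pos: "c > 0"
      using c D X_less X_pos by linarith
    have "outer y = 1/(a*c) - 1/(D*c)"
      using W_3[OF H, of x1 y x2] W_3[OF H, of x1 x2 y] clique12y dy
      by (auto simp: outer_def a_def c_def D_def insert_commute)
    then have outer: "D * outer y \<le> X / ((N - X) * (N - 2*X))"
      using outer_bound[OF D a c] by simp
    have inner: "D * inner y z \<le> 2*X / ((N - X) * (N - 4*X)) / c"
      if z: "z \<in> CN H {x1, x2, x3, y}" for z
    proof -
      have dz: "distinct [x1, x2, x3, y, z]"
        using mem_CN_not_mem[OF H _ _ z] dy by auto
      have clique5: "is_clique H 5 {x1, x2, x3, y, z}"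
        using is_clique_insert[OF H clique4 _ z] by (simp add: insert_commute)
      have clique12yz: "is_clique H 4 {x1, x2, y, z}"
        using is_clique_mono[OF clique5, of "{x1, x2, y, z}" 4] dz by simp
      define g where "g = real (deg H {y, z})"
      define k where "k = real (card (CN H {x1, x2, y, z}))"
      define c' where "c' = real (card (CN H {x1, y, z}))"
      have g: "N - X \<le> g" "g \<le> N"
        using deg_ge[OF clique5, of y z] dz deg_le by (auto simp: g_def)
      have z1: "N - X \<le> real (deg H {x1, z})" and z2: "N - X \<le> real (deg H {x2, z})"
        using deg_ge[OF clique5, of x1 z] deg_ge[OF clique5, of x2 z] dz by auto
      have k: "c - 2*X - (N - g) \<le> k"
        using card_CN_4_ge[OF fin, of x1 x2 y z] dz z1 z2
        by (simp add: c_def k_def g_def N_def)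
      have c': "g - 2*X \<le> c'"
        using card_CN_3_ge[OF fin, of x1 y z] dz z1 a
        by (simp add: a_def c'_def g_def N_def)
      \<comment> \<open>All four weights share the last factor \<open>k\<close>; the first two share
        \<open>c\<close> and the last two share \<open>c'\<close>, since these depend only on the
        sets of the first four or three vertices.\<close>
      have sets: "{x1, y, x2, z} = {x1, x2, y, z}" "{x1, y, z, x2} = {x1, x2, y, z}"
        "{y, z, x1, x2} = {x1, x2, y, z}" "{x1, y, x2} = {x1, x2, y}" "{y, z, x1} = {x1, y, z}"
        by auto
      have "inner y z = 1/(a*c*k) - 1/(D*c*k) + 1/(a*c'*k) - 1/(g*c'*k)"
        using W_4[OF H, of x1 y x2 z] W_4[OF H, of x1 x2 y z] W_4[OF H, of x1 y z x2]
          W_4[OF H, of y z x1 x2] clique12yz dz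
        unfolding sets by (auto simp: inner_def a_def c_def D_def g_def k_def c'_def)
      then show ?thesis
        using inner_bound[OF D a g c k c'] by simp
    qed
    \<comment> \<open>Every \<open>z\<close> is a common neighbour of \<open>{x1, x2, y}\<close>, so
      the number of summands is absorbed by the divisor \<open>c\<close> in the bound per
      \<open>z\<close>.\<close>
    have s_le: "real (card (CN H {x1, x2, x3, y})) \<le> c"
      unfolding c_def of_nat_le_iff
      using fin by (intro card_mono CN_antimono finite_subset[OF CN_subset_verts]) auto
    have "D * (\<Sum>z\<in>CN H {x1, x2, x3, y}. inner y z) = (\<Sum>z\<in>CN H {x1, x2, x3, y}. D * inner y z)"
      by (rule sum_distrib_left)
    also have "\<dots> \<le> real (card (CN H {x1, x2, x3, y})) * (2*X / ((N - X) * (N - 4*X)) / c)"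
      using inner by (rule sum_bounded_above)
    also have "\<dots> \<le> c * (2*X / ((N - X) * (N - 4*X)) / c)"
      using s_le c_pos X_less X_pos by (intro mult_right_mono) auto
    also have "\<dots> = 2*X / ((N - X) * (N - 4*X))"
      using c_pos by simp
    finally show ?thesis
      using outer bounds_sum by (simp add: distrib_left)
  qed
  \<comment> \<open>For a pair the common neighbourhood is \<open>nbhd\<close>, so the prefactor of
    \<open>w1\<close> is \<open>D\<close> and moves into the sum over at most \<open>N\<close>
    vertices \<open>y\<close>.\<close>
  have "w1 H (x1, x2, x3) =
      (\<Sum>y\<in>CN H {x1, x2, x3}. D * (outer y + (\<Sum>z\<in>CN H {x1, x2, x3, y}. inner y z)))"
    using assms(4) by (simp add: outer_def inner_def D_def CN_pair deg_def sum_distrib_left)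
  also have "\<dots> \<le> real (card (CN H {x1, x2, x3})) * (1 / N)"
    using y_bound by (rule sum_bounded_above)
  also have "\<dots> \<le> N * (1 / N)"
    using card_mono[OF fin CN_subset_verts] N by (intro mult_right_mono) (auto simp: N_def)
  finally show ?thesis
    using N by simp
qed

end
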